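(* Let $0\to\mathfrak h\xrightarrow{i}\hat{\mathfrak g}\xrightarrow{p}\mathfrak g\to0$ be a non-abelian extension of a Lie-Yamaguti algebra $\mathfrak g$ by a Lie-Yamaguti algebra $\mathfrak h$ with a section $s$ of $p$, and let $(\chi,\omega,\mu,\theta,D,\rho,T)$ be the non-abelian $(2,3)$-cocycle induced by $s$. A pair $(\alpha,\beta)\in\mathrm{Aut}(\mathfrak g)\times\mathrm{Aut}(\mathfrak h)$ is extensible if and only if the non-abelian $(2,3)$-cocycles $(\chi,\omega,\mu,\theta,D,\rho,T)$ and $(\chi_{(\alpha,\beta)},\omega_{(\alpha,\beta)},\mu_{(\alpha,\beta)},\theta_{(\alpha,\beta)},D_{(\alpha,\beta)},\rho_{(\alpha,\beta)},T_{(\alpha,\beta)})$ are equivalent.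
   Context: All vector spaces and algebras are over a field $k$. A Lie-Yamaguti algebra is a vector space $\mathfrak g$ with a bilinear map $[\cdot,\cdot]$ and a trilinear map $\{\cdot,\cdot,\cdot\}$ such that for all elements $[x_1,x_2]+[x_2,x_1]=0$, $\{x_1,x_2,x_3\}+\{x_2,x_1,x_3\}=0$; $[[x_1,x_2],x_3]+[[x_2,x_3],x_1]+[[x_3,x_1],x_2]+\{x_1,x_2,x_3\}+\{x_2,x_3,x_1\}+\{x_3,x_1,x_2\}=0$; $\{[x_1,x_2],x_3,y_1\}+\{[x_2,x_3],x_1,y_1\}+\{[x_3,x_1],x_2,y_1\}=0$; $\{x_1,x_2,[y_1,y_2]\}=[\{x_1,x_2,y_1\},y_2]+[y_1,\{x_1,x_2,y_2\}]$; $\{x_1,x_2,\{y_1,y_2,y_3\}\}=\{\{x_1,x_2,y_1\},y_2,y_3\}+\{y_1,\{x_1,x_2,y_2\},y_3\}+\{y_1,y_2,\{x_1,x_2,y_3\}\}$. Homomorphisms are linear maps preserving both operations; $\mathrm{Aut}$ denotes the group of automorphisms. A non-abelian extension of $\mathfrak g$ by $\mathfrak h$ is a short exact sequence of Lie-Yamaguti algebras $0\to\mathfrak h\xrightarrow{i}\hat{\mathfrak g}\xrightarrow{p}\mathfrak g\to0$; $\mathfrak h$ is identified with $i(\mathfrak h)$. A section of $p$ is a linear map $s$ with $ps=I_{\mathfrak g}$. The non-abelian $(2,3)$-cocycle induced by $s$ is the septuple: $\chi(x,y)=[s(x),s(y)]_{\hat{\mathfrak g}}-s[x,y]_{\mathfrak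 g}$, $\omega(x,y,z)=\{s(x),s(y),s(z)\}_{\hat{\mathfrak g}}-s\{x,y,z\}_{\mathfrak g}$, $\mu(x)a=[s(x),a]_{\hat{\mathfrak g}}$, $\theta(x,y)a=\{a,s(x),s(y)\}_{\hat{\mathfrak g}}$, $D(x,y)a=\{s(x),s(y),a\}_{\hat{\mathfrak g}}$, $\rho(x)(a,b)=\{s(x),a,b\}_{\hat{\mathfrak g}}$, $T(x)(a,b)=\{a,b,s(x)\}_{\hat{\mathfrak g}}$, for $x,y,z\in\mathfrak g$, $a,b\in\mathfrak h$. Let $\mathrm{Aut}_{\mathfrak h}(\hat{\mathfrak g})=\{\gamma\in\mathrm{Aut}(\hat{\mathfrak g})\mid\gamma(\mathfrak h)=\mathfrak h\}$. A pair $(\alpha,\beta)$ is extensible if there is $\gamma\in\mathrm{Aut}_{\mathfrak h}(\hat{\mathfrak g})$ with $i\beta=\gamma i$, $p\gamma=\alpha p$. For $(\alpha,\beta)\in\mathrm{Aut}(\mathfrak g)\times\mathrm{Aut}(\mathfrak h)$ put $\chi_{(\alpha,\beta)}(x,y)=\beta\chi(\alpha^{-1}(x),\alpha^{-1}(y))$, $\omega_{(\alpha,\beta)}(x,y,z)=\beta\omega(\alpha^{-1}(x),\alpha^{-1}(y),\alpha^{-1}(z))$, $\mu_{(\alpha,\beta)}(x)a=\beta\mu(\alpha^{-1}(x))\beta^{-1}(a)$, $\theta_{(\alpha,\beta)}(x,y)a=\beta\theta(\alpha^{-1}(x),\alpha^{-1}(y))\beta^{-1}(a)$, $D_{(\alpha,\beta)}(x,y)a=\beta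 D(\alpha^{-1}(x),\alpha^{-1}(y))\beta^{-1}(a)$, $\rho_{(\alpha,\beta)}(x)(a,b)=\beta\rho(\alpha^{-1}(x))(\beta^{-1}(a),\beta^{-1}(b))$, $T_{(\alpha,\beta)}(x)(a,b)=\beta T(\alpha^{-1}(x))(\beta^{-1}(a),\beta^{-1}(b))$. Two such septuples $(\chi_1,\omega_1,\mu_1,\theta_1,D_1,\rho_1,T_1)$ and $(\chi_2,\omega_2,\mu_2,\theta_2,D_2,\rho_2,T_2)$ (non-abelian $(2,3)$-cocycles on $\mathfrak g$ with values in $\mathfrak h$) are equivalent if there is a linear map $\varphi:\mathfrak g\to\mathfrak h$ such that for all $x,y,z\in\mathfrak g$, $a,b\in\mathfrak h$: $\chi_1(x,y)-\chi_2(x,y)=[\varphi(x),\varphi(y)]_{\mathfrak h}+\varphi[x,y]_{\mathfrak g}-\mu_2(x)\varphi(y)+\mu_2(y)\varphi(x)$; $\omega_1(x,y,z)-\omega_2(x,y,z)=\theta_2(x,z)\varphi(y)-D_2(x,y)\varphi(z)+\rho_2(x)(\varphi(y),\varphi(z))-\theta_2(y,z)\varphi(x)+T_2(z)(\varphi(x),\varphi(y))-\rho_2(y)(\varphi(x),\varphi(z))-\{\varphi(x),\varphi(y),\varphi(z)\}_{\mathfrak h}+\varphi\{x,y,z\}_{\mathfrak g}$; $\mu_1(x)a-\mu_2(x)a=[a,\varphi(x)]_{\mathfrak h}$; $\theta_1(x,y)a-\theta_2(x,y)a=\rho_2(x)(a,\varphi(y))-T_2(y)(a,\varphi(x))+\{a,\varphi(x),\varphi(y)\}_{\mathfrak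 h}$; $D_1(x,y)a-D_2(x,y)a=\rho_2(y)(\varphi(x),a)-\rho_2(x)(\varphi(y),a)+\{\varphi(x),\varphi(y),a\}_{\mathfrak h}$; $\rho_1(x)(a,b)-\rho_2(x)(a,b)=\{a,\varphi(x),b\}_{\mathfrak h}$; $T_1(x)(a,b)-T_2(x)(a,b)=\{b,a,\varphi(x)\}_{\mathfrak h}$. *)

theory Defs
  imports Complex_Main
begin

record ('k, 'a) ly_algebra =
  scale :: "'k \<Rightarrow> 'a \<Rightarrow> 'a"
  bracket :: "'a \<Rightarrow> 'a \<Rightarrow> 'a"
  triple :: "'a \<Rightarrow> 'a \<Rightarrow> 'a \<Rightarrow> 'a"

text \<open>The underlying space is a whole type; its additive group comes from the type class and
  the scalar multiplication from the record.\<close>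

locale lie_yamaguti =
  vector_space "scale L"
  for L :: "('k::field, 'a::ab_group_add) ly_algebra" +
  assumes bracket_linear_1: "\<And>y. Vector_Spaces.linear (scale L) (scale L) (\<lambda>x. bracket L x y)"
    and bracket_linear_2: "\<And>x. Vector_Spaces.linear (scale L) (scale L) (\<lambda>y. bracket L x y)"
    and triple_linear_1: "\<And>y z. Vector_Spaces.linear (scale L) (scale L) (\<lambda>x. triple L x y z)"
    and triple_linear_2: "\<And>x z. Vector_Spaces.linear (scale L) (scale L) (\<lambda>y. triple L x y z)"
    and triple_linear_3: "\<And>x y. Vector_Spaces.linear (scale L) (scale L) (\<lambda>z. triple L x y z)"
    and bracket_skew: "\<And>x1 x2. bracket L x1 x2 + bracket L x2 x1 = 0"
    and triple_skew: "\<And>x1 x2 x3. triple L x1 x2 x3 + triple L x2 x1 x3 = 0"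
    and bracket_triple_cyclic: "\<And>x1 x2 x3.
      bracket L (bracket L x1 x2) x3 + bracket L (bracket L x2 x3) x1
        + bracket L (bracket L x3 x1) x2
        + triple L x1 x2 x3 + triple L x2 x3 x1 + triple L x3 x1 x2 = 0"
    and triple_bracket_cyclic: "\<And>x1 x2 x3 y1.
      triple L (bracket L x1 x2) x3 y1 + triple L (bracket L x2 x3) x1 y1
        + triple L (bracket L x3 x1) x2 y1 = 0"
    and triple_derivation_bracket: "\<And>x1 x2 y1 y2.
      triple L x1 x2 (bracket L y1 y2)
        = bracket L (triple L x1 x2 y1) y2 + bracket L y1 (triple L x1 x2 y2)"
    and triple_derivation_triple: "\<And>x1 x2 y1 y2 y3.
      triple L x1 x2 (triple L y1 y2 y3)
        = triple L (triple L x1 x2 y1) y2 y3 + triple L y1 (triple L x1 x2 y2) y3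
          + triple L y1 y2 (triple L x1 x2 y3)"

definition ly_hom ::
  "('k::field, 'a::ab_group_add) ly_algebra \<Rightarrow> ('k, 'b::ab_group_add) ly_algebra \<Rightarrow> ('a \<Rightarrow> 'b) set"
  where "ly_hom L M = {f. Vector_Spaces.linear (scale L) (scale M) f
    \<and> (\<forall>x y. f (bracket L x y) = bracket M (f x) (f y))
    \<and> (\<forall>x y z. f (triple L x y z) = triple M (f x) (f y) (f z))}"

definition ly_aut :: "('k::field, 'a::ab_group_add) ly_algebra \<Rightarrow> ('a \<Rightarrow> 'a) set"
  where "ly_aut L = {f \<in> ly_hom L L. bij f}"

text \<open>A short exact sequence \<open>0 \<rightarrow> H \<rightarrow> E \<rightarrow> G \<rightarrow> 0\<close> with maps \<open>i\<close> and \<open>p\<close>.\<close>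

locale nonabelian_extension =
  G: lie_yamaguti G + H: lie_yamaguti H + E: lie_yamaguti E
  for G :: "('k::field, 'g::ab_group_add) ly_algebra"
    and H :: "('k, 'h::ab_group_add) ly_algebra"
    and E :: "('k, 'e::ab_group_add) ly_algebra"
    and i :: "'h \<Rightarrow> 'e" and p :: "'e \<Rightarrow> 'g" +
  assumes i_hom: "i \<in> ly_hom H E"
    and p_hom: "p \<in> ly_hom E G"
    and i_inj: "inj i"
    and exact: "range i = {e. p e = 0}"
    and p_surj: "surj p"

definition is_section ::
  "('k::field, 'g::ab_group_add) ly_algebra \<Rightarrow> ('k, 'e::ab_group_add) ly_algebra
    \<Rightarrow> ('e \<Rightarrow> 'g) \<Rightarrow> ('g \<Rightarrow> 'e) \<Rightarrow> bool"
  where "is_section G E p s \<longleftrightarrow> Vector_Spaces.linear (scale G) (scale E) s \<and> p \<circ> s = id"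

record ('g, 'h) septuple =
  chi :: "'g \<Rightarrow> 'g \<Rightarrow> 'h"
  omega :: "'g \<Rightarrow> 'g \<Rightarrow> 'g \<Rightarrow> 'h"
  mu :: "'g \<Rightarrow> 'h \<Rightarrow> 'h"
  theta :: "'g \<Rightarrow> 'g \<Rightarrow> 'h \<Rightarrow> 'h"
  Dmap :: "'g \<Rightarrow> 'g \<Rightarrow> 'h \<Rightarrow> 'h"
  rho :: "'g \<Rightarrow> 'h \<Rightarrow> 'h \<Rightarrow> 'h"
  Tmap :: "'g \<Rightarrow> 'h \<Rightarrow> 'h \<Rightarrow> 'h"

text \<open>The identification of \<open>H\<close> with \<open>range i\<close> is made explicit by \<open>inv i\<close>. In a non-abelian
  extension with section \<open>s\<close>, every argument of \<open>inv i\<close> below lies in the kernel of \<open>p\<close>,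
  which is \<open>range i\<close>.\<close>

definition induced_cocycle ::
  "('k::field, 'g::ab_group_add) ly_algebra \<Rightarrow> ('k, 'e::ab_group_add) ly_algebra
    \<Rightarrow> ('h::ab_group_add \<Rightarrow> 'e) \<Rightarrow> ('g \<Rightarrow> 'e) \<Rightarrow> ('g, 'h) septuple"
  where "induced_cocycle G E i s = \<lparr>
    chi = (\<lambda>x y. inv i (bracket E (s x) (s y) - s (bracket G x y))),
    omega = (\<lambda>x y z. inv i (triple E (s x) (s y) (s z) - s (triple G x y z))),
    mu = (\<lambda>x a. inv i (bracket E (s x) (i a))),
    theta = (\<lambda>x y a. inv i (triple E (i a) (s x) (s y))),
    Dmap = (\<lambda>x y a. inv i (triple E (s x) (s y) (i a))),
    rho = (\<lambda>x a b. inv i (triple E (s x) (i a) (i b))),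
    Tmap = (\<lambda>x a b. inv i (triple E (i a) (i b) (s x))) \<rparr>"

definition twist :: "('g \<Rightarrow> 'g) \<Rightarrow> ('h \<Rightarrow> 'h) \<Rightarrow> ('g, 'h) septuple \<Rightarrow> ('g, 'h) septuple"
  where "twist \<alpha> \<beta> c = \<lparr>
    chi = (\<lambda>x y. \<beta> (chi c (inv \<alpha> x) (inv \<alpha> y))),
    omega = (\<lambda>x y z. \<beta> (omega c (inv \<alpha> x) (inv \<alpha> y) (inv \<alpha> z))),
    mu = (\<lambda>x a. \<beta> (mu c (inv \<alpha> x) (inv \<beta> a))),
    theta = (\<lambda>x y a. \<beta> (theta c (inv \<alpha> x) (inv \<alpha> y) (inv \<beta> a))),
    Dmap = (\<lambda>x y a. \<beta> (Dmap c (inv \<alpha> x) (inv \<alpha> y) (inv \<beta> a))),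
    rho = (\<lambda>x a b. \<beta> (rho c (inv \<alpha> x) (inv \<beta> a) (inv \<beta> b))),
    Tmap = (\<lambda>x a b. \<beta> (Tmap c (inv \<alpha> x) (inv \<beta> a) (inv \<beta> b))) \<rparr>"

definition equivalent_cocycles ::
  "('k::field, 'g::ab_group_add) ly_algebra \<Rightarrow> ('k, 'h::ab_group_add) ly_algebra
    \<Rightarrow> ('g, 'h) septuple \<Rightarrow> ('g, 'h) septuple \<Rightarrow> bool"
  where "equivalent_cocycles G H c1 c2 \<longleftrightarrow>
    (\<exists>\<phi>. Vector_Spaces.linear (scale G) (scale H) \<phi>
      \<and> (\<forall>x y. chi c1 x y - chi c2 x y
            = bracket H (\<phi> x) (\<phi> y) + \<phi> (bracket G x y) - mu c2 x (\<phi> y) + mu c2 y (\<phi> x))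
      \<and> (\<forall>x y z. omega c1 x y z - omega c2 x y z
            = theta c2 x z (\<phi> y) - Dmap c2 x y (\<phi> z) + rho c2 x (\<phi> y) (\<phi> z)
              - theta c2 y z (\<phi> x) + Tmap c2 z (\<phi> x) (\<phi> y) - rho c2 y (\<phi> x) (\<phi> z)
              - triple H (\<phi> x) (\<phi> y) (\<phi> z) + \<phi> (triple G x y z))
      \<and> (\<forall>x a. mu c1 x a - mu c2 x a = bracket H a (\<phi> x))
      \<and> (\<forall>x y a. theta c1 x y a - theta c2 x y a
            = rho c2 x a (\<phi> y) - Tmap c2 y a (\<phi> x) + triple H a (\<phi> x) (\<phi> y))
      \<and> (\<forall>x y a. Dmap c1 x y a - Dmap c2 x y a
            = rho c2 y (\<phi> x) a - rho c2 x (\<phi> y) a + triple H (\<phi> x) (\<phi> y) a)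
      \<and> (\<forall>x a b. rho c1 x a b - rho c2 x a b = triple H a (\<phi> x) b)
      \<and> (\<forall>x a b. Tmap c1 x a b - Tmap c2 x a b = triple H b a (\<phi> x)))"

definition aut_preserving ::
  "('k::field, 'e::ab_group_add) ly_algebra \<Rightarrow> 'e set \<Rightarrow> ('e \<Rightarrow> 'e) set"
  where "aut_preserving E S = {\<gamma> \<in> ly_aut E. \<gamma> ` S = S}"

definition extensible ::
  "('k::field, 'e::ab_group_add) ly_algebra \<Rightarrow> ('h \<Rightarrow> 'e) \<Rightarrow> ('e \<Rightarrow> 'g)
    \<Rightarrow> ('g \<Rightarrow> 'g) \<Rightarrow> ('h \<Rightarrow> 'h) \<Rightarrow> bool"
  where "extensible E i p \<alpha> \<beta> \<longleftrightarrow>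
    (\<exists>\<gamma> \<in> aut_preserving E (range i). i \<circ> \<beta> = \<gamma> \<circ> i \<and> p \<circ> \<gamma> = \<alpha> \<circ> p)"

end

theory Submission
  imports Defs
begin

text \<open>
  Two observations carry the proof.

  First, fix the section \<open>s\<close>. The equations defining equivalence via \<open>\<phi>\<close>, with the cocycle of
  \<open>s\<close> as first argument, hold when the second is the cocycle of the section \<open>s + i \<circ> \<phi>\<close>: they
  are what multilinearity and skew-symmetry give for the differences. They also determine
  the second cocycle: \<open>mu\<close>, \<open>rho\<close> and \<open>Tmap\<close> directly, then
  \<open>theta\<close> and \<open>Dmap\<close>, then \<open>chi\<close> and \<open>omega\<close>. As any two sections differ by some \<open>i \<circ> \<phi>\<close>, a
  septuple is equivalent to the cocycle of \<open>s\<close> exactly when it is the cocycle of some section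
  \<open>t\<close> (\<open>equivalent_induced_iff\<close>).

  Second, transport of structure. If \<open>\<gamma>\<close> extends \<open>(\<alpha>, \<beta>)\<close>, then \<open>t = \<gamma> \<circ> s \<circ> inv \<alpha>\<close> is a
  section whose cocycle is the twist by \<open>(\<alpha>, \<beta>)\<close> of the cocycle of \<open>s\<close> (\<open>twist_induced\<close>).
  Conversely, if the twist is the cocycle of a section \<open>t\<close>, put
  \<open>\<gamma> (s x + i a) = t (\<alpha> x) + i (\<beta> a)\<close>, which is well defined because \<open>E\<close> is the direct sum of
  the images of \<open>s\<close> and \<open>i\<close>. By multilinearity it suffices to check that \<open>\<gamma>\<close> respects the
  operations on arguments from these two summands, and there the condition is the equality of
  the components of the two septuples (\<open>extensible_if_twist_induced\<close>).
\<close>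

section \<open>Linearity and skew-symmetry\<close>

lemma linear_rules:
  assumes "Vector_Spaces.linear s1 s2 f"
  shows linear_add_rule: "f (x + y) = f x + f y"
    and linear_scale_rule: "f (s1 r x) = s2 r (f x)"
    and linear_diff_rule: "f (x - y) = f x - f y"
    and linear_minus_rule: "f (- x) = - f x"
    and linear_zero_rule: "f 0 = 0"
proof -
  interpret Vector_Spaces.linear s1 s2 f by (fact assms)
  show "f (x + y) = f x + f y" "f (s1 r x) = s2 r (f x)" "f (x - y) = f x - f y"
    "f (- x) = - f x" "f 0 = 0"
    by (rule add scale diff neg zero)+
qed

lemma linearI:
  assumes "vector_space s1" "vector_space s2"
    and "\<And>x y. f (x + y) = f x + f y" "\<And>r x. f (s1 r x) = s2 r (f x)"
  shows "Vector_Spaces.linear s1 s2 f"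
  using assms by (simp add: Vector_Spaces.linear_iff)

lemma ly_homD:
  assumes "f \<in> ly_hom L M"
  shows "Vector_Spaces.linear (scale L) (scale M) f"
    and "f (bracket L x y) = bracket M (f x) (f y)"
    and "f (triple L x y z) = triple M (f x) (f y) (f z)"
  using assms by (auto simp: ly_hom_def)

lemma ly_autD:
  assumes "f \<in> ly_aut L"
  shows "f \<in> ly_hom L L" and "f (inv f x) = x" and "inv f (f x) = x"
  using assms by (auto simp: ly_aut_def bij_def surj_f_inv_f)

context lie_yamaguti
begin

lemmas bracket_left = linear_rules[OF bracket_linear_1]
lemmas bracket_right = linear_rules[OF bracket_linear_2]
lemmas triple_first = linear_rules[OF triple_linear_1]
lemmas triple_second = linear_rules[OF triple_linear_2]
lemmas triple_third = linear_rules[OF triple_linear_3]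
lemmas multilinear = bracket_left bracket_right triple_first triple_second triple_third

lemma bracket_swap: "bracket L x y = - bracket L y x"
  using bracket_skew[of x y] by (simp add: eq_neg_iff_add_eq_0)

lemma triple_swap: "triple L x y z = - triple L y x z"
  using triple_skew[of x y z] by (simp add: eq_neg_iff_add_eq_0)

end

context nonabelian_extension
begin

section \<open>Sections and their cocycles\<close>

lemmas i_linear = ly_homD(1)[OF i_hom]
lemmas p_linear = ly_homD(1)[OF p_hom]
lemmas i_rules = linear_rules[OF i_linear]
lemmas p_rules = linear_rules[OF p_linear]
lemmas i_bracket = ly_homD(2)[OF i_hom]
lemmas i_triple = ly_homD(3)[OF i_hom]
lemmas p_bracket = ly_homD(2)[OF p_hom]
lemmas p_triple = ly_homD(3)[OF p_hom]

lemma p_i [simp]: "p (i a) = 0"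
  using exact by auto

lemma inv_i_i [simp]: "inv i (i a) = a"
  by (simp add: i_inj)

lemma i_inv_i: "p e = 0 \<Longrightarrow> i (inv i e) = e"
  using exact by (auto intro: f_inv_into_f)

lemma i_eq_iff: "i a = i b \<longleftrightarrow> a = b"
  using i_inj by (auto dest: injD)

lemma sectionD:
  assumes "is_section G E p s"
  shows "Vector_Spaces.linear (scale G) (scale E) s" and "p (s x) = x"
  using assms by (auto simp: is_section_def dest: fun_cong)

lemma i_induced:
  assumes "is_section G E p s"
  shows "i (chi (induced_cocycle G E i s) x y) = bracket E (s x) (s y) - s (bracket G x y)"
    and "i (omega (induced_cocycle G E i s) x y z)
      = triple E (s x) (s y) (s z) - s (triple G x y z)"
    and "i (mu (induced_cocycle G E i s) x a) = bracket E (s x) (i a)"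
    and "i (theta (induced_cocycle G E i s) x y a) = triple E (i a) (s x) (s y)"
    and "i (Dmap (induced_cocycle G E i s) x y a) = triple E (s x) (s y) (i a)"
    and "i (rho (induced_cocycle G E i s) x a b) = triple E (s x) (i a) (i b)"
    and "i (Tmap (induced_cocycle G E i s) x a b) = triple E (i a) (i b) (s x)"
  unfolding induced_cocycle_def
  by (auto intro!: i_inv_i
      simp: p_rules p_bracket p_triple sectionD(2)[OF assms] G.multilinear)

lemma section_add_i:
  assumes "is_section G E p s" and "Vector_Spaces.linear (scale G) (scale H) \<phi>"
  shows "is_section G E p (\<lambda>x. s x + i (\<phi> x))"
  unfolding is_section_def
proof
  show "Vector_Spaces.linear (scale G) (scale E) (\<lambda>x. s x + i (\<phi> x))"
    by (rule linearI)
      (simp_all add: G.vector_space_axioms E.vector_space_axioms E.scale_right_distrib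
        linear_rules[OF sectionD(1)[OF assms(1)]] linear_rules[OF assms(2)] i_rules)
  show "p \<circ> (\<lambda>x. s x + i (\<phi> x)) = id"
    by (auto simp: p_rules sectionD(2)[OF assms(1)])
qed

lemma sections_differ:
  assumes s: "is_section G E p s" and t: "is_section G E p t"
  obtains \<phi> where "Vector_Spaces.linear (scale G) (scale H) \<phi>"
    and "t = (\<lambda>x. s x + i (\<phi> x))"
proof
  define \<phi> where "\<phi> = (\<lambda>x. inv i (t x - s x))"
  have i\<phi>: "i (\<phi> x) = t x - s x" for x
    by (simp add: \<phi>_def i_inv_i p_rules sectionD(2)[OF s] sectionD(2)[OF t])
  show "Vector_Spaces.linear (scale G) (scale H) \<phi>"
  proof (rule linearI)
    fix x y r
    show "\<phi> (x + y) = \<phi> x + \<phi> y" "\<phi> (scale G r x) = scale H r (\<phi> x)"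
      by (simp_all add: i_eq_iff[symmetric] i_rules i\<phi> E.scale_right_diff_distrib
          linear_rules[OF sectionD(1)[OF s]] linear_rules[OF sectionD(1)[OF t]])
  qed (rule G.vector_space_axioms H.vector_space_axioms)+
  show "t = (\<lambda>x. s x + i (\<phi> x))"
    by (simp add: i\<phi>)
qed

section \<open>Equivalence as change of section\<close>

text \<open>The equations of equivalence for a prescribed \<open>\<phi>\<close>.\<close>

definition equivalent_via :: "('g \<Rightarrow> 'h) \<Rightarrow> ('g, 'h) septuple \<Rightarrow> ('g, 'h) septuple \<Rightarrow> bool"
  where "equivalent_via \<phi> c1 c2 \<longleftrightarrow>
      (\<forall>x y. chi c1 x y - chi c2 x y
            = bracket H (\<phi> x) (\<phi> y) + \<phi> (bracket G x y) - mu c2 x (\<phi> y) + mu c2 y (\<phi> x))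
      \<and> (\<forall>x y z. omega c1 x y z - omega c2 x y z
            = theta c2 x z (\<phi> y) - Dmap c2 x y (\<phi> z) + rho c2 x (\<phi> y) (\<phi> z)
              - theta c2 y z (\<phi> x) + Tmap c2 z (\<phi> x) (\<phi> y) - rho c2 y (\<phi> x) (\<phi> z)
              - triple H (\<phi> x) (\<phi> y) (\<phi> z) + \<phi> (triple G x y z))
      \<and> (\<forall>x a. mu c1 x a - mu c2 x a = bracket H a (\<phi> x))
      \<and> (\<forall>x y a. theta c1 x y a - theta c2 x y a
            = rho c2 x a (\<phi> y) - Tmap c2 y a (\<phi> x) + triple H a (\<phi> x) (\<phi> y))
      \<and> (\<forall>x y a. Dmap c1 x y a - Dmap c2 x y a
            = rho c2 y (\<phi> x) a - rho c2 x (\<phi> y) a + triple H (\<phi> x) (\<phi> y) a)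
      \<and> (\<forall>x a b. rho c1 x a b - rho c2 x a b = triple H a (\<phi> x) b)
      \<and> (\<forall>x a b. Tmap c1 x a b - Tmap c2 x a b = triple H b a (\<phi> x))"

lemma equivalent_cocycles_iff_via:
  "equivalent_cocycles G H c1 c2 \<longleftrightarrow>
    (\<exists>\<phi>. Vector_Spaces.linear (scale G) (scale H) \<phi> \<and> equivalent_via \<phi> c1 c2)"
  by (simp add: equivalent_cocycles_def equivalent_via_def)

lemma equivalent_viaD:
  assumes "equivalent_via \<phi> c1 c2"
  shows "chi c1 x y - chi c2 x y
      = bracket H (\<phi> x) (\<phi> y) + \<phi> (bracket G x y) - mu c2 x (\<phi> y) + mu c2 y (\<phi> x)"
    and "omega c1 x y z - omega c2 x y z
      = theta c2 x z (\<phi> y) - Dmap c2 x y (\<phi> z) + rho c2 x (\<phi> y) (\<phi> z)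
        - theta c2 y z (\<phi> x) + Tmap c2 z (\<phi> x) (\<phi> y) - rho c2 y (\<phi> x) (\<phi> z)
        - triple H (\<phi> x) (\<phi> y) (\<phi> z) + \<phi> (triple G x y z)"
    and "mu c1 x a - mu c2 x a = bracket H a (\<phi> x)"
    and "theta c1 x y a - theta c2 x y a
      = rho c2 x a (\<phi> y) - Tmap c2 y a (\<phi> x) + triple H a (\<phi> x) (\<phi> y)"
    and "Dmap c1 x y a - Dmap c2 x y a
      = rho c2 y (\<phi> x) a - rho c2 x (\<phi> y) a + triple H (\<phi> x) (\<phi> y) a"
    and "rho c1 x a b - rho c2 x a b = triple H a (\<phi> x) b"
    and "Tmap c1 x a b - Tmap c2 x a b = triple H b a (\<phi> x)"
  using assms by (simp_all only: equivalent_via_def)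

lemma equivalent_via_unique:
  assumes c: "equivalent_via \<phi> c1 c" and d: "equivalent_via \<phi> c1 d"
  shows "c = d"
proof -
  have cancel: "v = w" if "u - v = r" "u - w = r" for u v w r :: 'h
    using that by (metis diff_diff_eq2 add_diff_cancel_left')
  note cD = equivalent_viaD[OF c] and dD = equivalent_viaD[OF d]
  have mu: "mu c = mu d" by (intro ext cancel[OF cD(3) dD(3)])
  have rho: "rho c = rho d" by (intro ext cancel[OF cD(6) dD(6)])
  have Tmap: "Tmap c = Tmap d" by (intro ext cancel[OF cD(7) dD(7)])
  note 1 = mu rho Tmap
  have theta: "theta c = theta d" by (intro ext cancel[OF cD(4)[unfolded 1] dD(4)])
  have Dmap: "Dmap c = Dmap d" by (intro ext cancel[OF cD(5)[unfolded 1] dD(5)])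
  note 2 = 1 theta Dmap
  have chi: "chi c = chi d" by (intro ext cancel[OF cD(1)[unfolded 2] dD(1)])
  have omega: "omega c = omega d" by (intro ext cancel[OF cD(2)[unfolded 2] dD(2)])
  from 2 chi omega show ?thesis by simp
qed

lemma equivalent_via_induced:
  assumes s: "is_section G E p s" and \<phi>: "Vector_Spaces.linear (scale G) (scale H) \<phi>"
  shows "equivalent_via \<phi> (induced_cocycle G E i s)
    (induced_cocycle G E i (\<lambda>x. s x + i (\<phi> x)))"
proof -
  note t = section_add_i[OF s \<phi>]
  note expand = i_eq_iff[symmetric] i_rules i_bracket i_triple i_induced[OF s] i_induced[OF t]
    E.multilinear
  \<comment> \<open>Skew-symmetry moves arguments from the kernel behind arguments from the section, in the
    first two slots.\<close>
  note swap = E.bracket_swap[of "i a" "s x" for a x]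
    E.triple_swap[of "i a" "s x" e for a x e]
  show ?thesis
    unfolding equivalent_via_def
    \<comment> \<open>What remains after the expansion are products with two arguments \<open>i _\<close> in the first two
      slots, in either order.\<close>
    by (intro conjI allI;
        simp add: expand swap algebra_simps;
        simp add: E.bracket_skew E.triple_skew E.bracket_swap[symmetric]
          E.triple_swap[symmetric])
qed

lemma equivalent_induced_iff:
  assumes s: "is_section G E p s"
  shows "equivalent_cocycles G H (induced_cocycle G E i s) c \<longleftrightarrow>
    (\<exists>t. is_section G E p t \<and> c = induced_cocycle G E i t)"
proof
  assume "equivalent_cocycles G H (induced_cocycle G E i s) c"
  then obtain \<phi> where \<phi>: "Vector_Spaces.linear (scale G) (scale H) \<phi>"
    and "equivalent_via \<phi> (induced_cocycle G E i s) c"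
    by (auto simp: equivalent_cocycles_iff_via)
  then have "c = induced_cocycle G E i (\<lambda>x. s x + i (\<phi> x))"
    using equivalent_via_unique equivalent_via_induced[OF s \<phi>] by blast
  with section_add_i[OF s \<phi>]
  show "\<exists>t. is_section G E p t \<and> c = induced_cocycle G E i t" by blast
next
  assume "\<exists>t. is_section G E p t \<and> c = induced_cocycle G E i t"
  then obtain t where t: "is_section G E p t" and c: "c = induced_cocycle G E i t" by blast
  obtain \<phi> where "Vector_Spaces.linear (scale G) (scale H) \<phi>" "t = (\<lambda>x. s x + i (\<phi> x))"
    using sections_differ[OF s t] .
  then show "equivalent_cocycles G H (induced_cocycle G E i s) c"
    using equivalent_via_induced[OF s] c by (auto simp: equivalent_cocycles_iff_via)
qed

section \<open>Extensions of a pair of automorphisms\<close>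

text \<open>An endomorphism \<open>\<gamma>\<close> of \<open>E\<close> compatible with \<open>\<alpha>\<close> and \<open>\<beta>\<close> carries \<open>s\<close> to a new section, and
  the structure maps of \<open>s\<close> to those of the new section.\<close>

lemma twist_induced:
  assumes s: "is_section G E p s" and \<alpha>: "\<alpha> \<in> ly_aut G" and \<beta>: "\<beta> \<in> ly_aut H"
    and \<gamma>: "\<gamma> \<in> ly_hom E E" and \<gamma>i: "\<And>a. \<gamma> (i a) = i (\<beta> a)" and p\<gamma>: "\<And>e. p (\<gamma> e) = \<alpha> (p e)"
  shows "is_section G E p (\<lambda>x. \<gamma> (s (inv \<alpha> x)))"
    and "twist \<alpha> \<beta> (induced_cocycle G E i s)
      = induced_cocycle G E i (\<lambda>x. \<gamma> (s (inv \<alpha> x)))"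
proof -
  note \<alpha>_hom = ly_autD(1)[OF \<alpha>]
  note \<alpha>_rules = linear_rules[OF ly_homD(1)[OF \<alpha>_hom]]
  note s_rules = linear_rules[OF sectionD(1)[OF s]]
  note \<gamma>_rules = linear_rules[OF ly_homD(1)[OF \<gamma>]]
  have \<alpha>_inj: "u = v" if "\<alpha> u = \<alpha> v" for u v
    using that by (metis ly_autD(3)[OF \<alpha>])
  have inv\<alpha>: "inv \<alpha> (x + y) = inv \<alpha> x + inv \<alpha> y" "inv \<alpha> (scale G r x) = scale G r (inv \<alpha> x)"
    "inv \<alpha> (bracket G x y) = bracket G (inv \<alpha> x) (inv \<alpha> y)"
    "inv \<alpha> (triple G x y z) = triple G (inv \<alpha> x) (inv \<alpha> y) (inv \<alpha> z)" for x y z r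
    by (rule \<alpha>_inj, simp add: ly_autD(2)[OF \<alpha>] \<alpha>_rules ly_homD(2,3)[OF \<alpha>_hom])+
  show t: "is_section G E p (\<lambda>x. \<gamma> (s (inv \<alpha> x)))"
    unfolding is_section_def
  proof
    show "Vector_Spaces.linear (scale G) (scale E) (\<lambda>x. \<gamma> (s (inv \<alpha> x)))"
      by (rule linearI)
        (simp_all add: G.vector_space_axioms E.vector_space_axioms inv\<alpha> s_rules \<gamma>_rules)
    show "p \<circ> (\<lambda>x. \<gamma> (s (inv \<alpha> x))) = id"
      by (auto simp: p\<gamma> sectionD(2)[OF s] ly_autD(2)[OF \<alpha>])
  qed
  note to_E = twist_def i_eq_iff[symmetric] \<gamma>i[symmetric] i_induced[OF s] i_induced[OF t]
    \<gamma>_rules ly_homD(2,3)[OF \<gamma>] inv\<alpha>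
  have i_\<gamma>: "\<gamma> (i (inv \<beta> a)) = i a" for a
    by (simp add: \<gamma>i ly_autD(2)[OF \<beta>])
  show "twist \<alpha> \<beta> (induced_cocycle G E i s) = induced_cocycle G E i (\<lambda>x. \<gamma> (s (inv \<alpha> x)))"
    by (rule septuple.equality; (intro ext)?; simp add: to_E i_\<gamma>)
qed

lemma extensible_if_twist_induced:
  assumes s: "is_section G E p s" and t: "is_section G E p t"
    and \<alpha>: "\<alpha> \<in> ly_aut G" and \<beta>: "\<beta> \<in> ly_aut H"
    and twist: "twist \<alpha> \<beta> (induced_cocycle G E i s) = induced_cocycle G E i t"
  shows "extensible E i p \<alpha> \<beta>"
proof -
  let ?c = "induced_cocycle G E i s"
  note \<alpha>_hom = ly_autD(1)[OF \<alpha>] and \<beta>_hom = ly_autD(1)[OF \<beta>]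
  note \<alpha>_rules = linear_rules[OF ly_homD(1)[OF \<alpha>_hom]] ly_homD(2,3)[OF \<alpha>_hom]
  note \<beta>_rules = linear_rules[OF ly_homD(1)[OF \<beta>_hom]] ly_homD(2,3)[OF \<beta>_hom]
  note s_rules = linear_rules[OF sectionD(1)[OF s]]
  note t_rules = linear_rules[OF sectionD(1)[OF t]]
  define \<gamma> where "\<gamma> e = t (\<alpha> (p e)) + i (\<beta> (inv i (e - s (p e))))" for e
  have \<gamma>_split: "\<gamma> (s x + i a) = t (\<alpha> x) + i (\<beta> a)" for x a
    by (simp add: \<gamma>_def p_rules sectionD(2)[OF s])
  have split: "\<exists>x a. e = s x + i a" for e
    by (rule exI[of _ "p e"], rule exI[of _ "inv i (e - s (p e))"])
      (simp add: i_inv_i p_rules sectionD(2)[OF s])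
  have \<gamma>_s: "\<gamma> (s x) = t (\<alpha> x)" and \<gamma>_i: "\<gamma> (i a) = i (\<beta> a)" for x a
    using \<gamma>_split[of x 0] \<gamma>_split[of 0 a] by (simp_all add: i_rules \<alpha>_rules \<beta>_rules s_rules t_rules)
  have \<gamma>_lin: "Vector_Spaces.linear (scale E) (scale E) \<gamma>"
  proof (rule linearI)
    fix e f r
    obtain x a y b where e: "e = s x + i a" and f: "f = s y + i b"
      using split by meson
    have ef: "e + f = s (x + y) + i (a + b)"
      and re: "scale E r e = s (scale G r x) + i (scale H r a)"
      by (simp_all add: e f i_rules s_rules E.scale_right_distrib)
    show "\<gamma> (e + f) = \<gamma> e + \<gamma> f"
      unfolding ef \<gamma>_split by (simp add: e f \<gamma>_split \<alpha>_rules \<beta>_rules t_rules i_rules)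
    show "\<gamma> (scale E r e) = scale E r (\<gamma> e)"
      unfolding re \<gamma>_split
      by (simp add: e \<gamma>_split \<alpha>_rules \<beta>_rules t_rules i_rules E.scale_right_distrib)
  qed (rule E.vector_space_axioms)+
  note \<gamma>_rules = linear_rules[OF \<gamma>_lin]
  \<comment> \<open>The hypothesis on the twist, evaluated at the arguments \<open>\<alpha> x\<close> and \<open>\<beta> a\<close>.\<close>
  have components:
    "\<beta> (chi ?c x y) = chi (induced_cocycle G E i t) (\<alpha> x) (\<alpha> y)"
    "\<beta> (omega ?c x y z) = omega (induced_cocycle G E i t) (\<alpha> x) (\<alpha> y) (\<alpha> z)"
    "\<beta> (mu ?c x a) = mu (induced_cocycle G E i t) (\<alpha> x) (\<beta> a)"
    "\<beta> (theta ?c x y a) = theta (induced_cocycle G E i t) (\<alpha> x) (\<alpha> y) (\<beta> a)"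
    "\<beta> (Dmap ?c x y a) = Dmap (induced_cocycle G E i t) (\<alpha> x) (\<alpha> y) (\<beta> a)"
    "\<beta> (rho ?c x a b) = rho (induced_cocycle G E i t) (\<alpha> x) (\<beta> a) (\<beta> b)"
    "\<beta> (Tmap ?c x a b) = Tmap (induced_cocycle G E i t) (\<alpha> x) (\<beta> a) (\<beta> b)" for x y z a b
    unfolding twist[symmetric] by (simp_all add: twist_def ly_autD(3)[OF \<alpha>] ly_autD(3)[OF \<beta>])
  \<comment> \<open>The same equations after applying \<open>i\<close>, read as values of \<open>\<gamma>\<close> on elements of \<open>E\<close>.\<close>
  note images = components[THEN arg_cong[of _ _ i], folded \<gamma>_i,
    unfolded i_induced[OF s] i_induced[OF t]]
  have on_bracket:
    "\<gamma> (bracket E (s x) (s y)) = bracket E (t (\<alpha> x)) (t (\<alpha> y))"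
    "\<gamma> (bracket E (s x) (i a)) = bracket E (t (\<alpha> x)) (i (\<beta> a))"
    "\<gamma> (bracket E (i a) (s x)) = bracket E (i (\<beta> a)) (t (\<alpha> x))"
    "\<gamma> (bracket E (i a) (i b)) = bracket E (i (\<beta> a)) (i (\<beta> b))" for x y a b
    using images(1)[of x y] images(3)[of x a]
    by (simp_all add: \<gamma>_rules \<gamma>_s \<alpha>_rules \<gamma>_i \<beta>_rules i_bracket[symmetric]
        E.bracket_swap[of "i _" "s _"] E.bracket_swap[of "i _" "t _"])
  have on_triple:
    "\<gamma> (triple E (s x) (s y) (s z)) = triple E (t (\<alpha> x)) (t (\<alpha> y)) (t (\<alpha> z))"
    "\<gamma> (triple E (s x) (s y) (i a)) = triple E (t (\<alpha> x)) (t (\<alpha> y)) (i (\<beta> a))"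
    "\<gamma> (triple E (i a) (s x) (s y)) = triple E (i (\<beta> a)) (t (\<alpha> x)) (t (\<alpha> y))"
    "\<gamma> (triple E (s x) (i a) (s y)) = triple E (t (\<alpha> x)) (i (\<beta> a)) (t (\<alpha> y))"
    "\<gamma> (triple E (s x) (i a) (i b)) = triple E (t (\<alpha> x)) (i (\<beta> a)) (i (\<beta> b))"
    "\<gamma> (triple E (i a) (s x) (i b)) = triple E (i (\<beta> a)) (t (\<alpha> x)) (i (\<beta> b))"
    "\<gamma> (triple E (i a) (i b) (s x)) = triple E (i (\<beta> a)) (i (\<beta> b)) (t (\<alpha> x))"
    "\<gamma> (triple E (i a) (i b) (i c)) = triple E (i (\<beta> a)) (i (\<beta> b)) (i (\<beta> c))" for x y z a b c
    using images(2)[of x y z] images(4)[of a x y] images(5)[of x y a] images(6)[of x a b]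
      images(7)[of a b x]
    by (simp_all add: \<gamma>_rules \<gamma>_s \<alpha>_rules \<gamma>_i \<beta>_rules i_triple[symmetric]
        E.triple_swap[of "s _" "i _" "s _"] E.triple_swap[of "t _" "i _" "t _"]
        E.triple_swap[of "i _" "s _" "i _"] E.triple_swap[of "i _" "t _" "i _"])
  have \<gamma>_hom: "\<gamma> \<in> ly_hom E E"
    unfolding ly_hom_def
  proof (intro CollectI conjI allI \<gamma>_lin)
    fix d e f
    obtain x a y b z c where d: "d = s x + i a" and e: "e = s y + i b" and f: "f = s z + i c"
      using split by meson
    show "\<gamma> (bracket E d e) = bracket E (\<gamma> d) (\<gamma> e)"
      by (simp add: d e \<gamma>_s \<gamma>_i E.multilinear \<gamma>_rules(1) on_bracket)
    show "\<gamma> (triple E d e f) = triple E (\<gamma> d) (\<gamma> e) (\<gamma> f)"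
      by (simp add: d e f \<gamma>_s \<gamma>_i E.multilinear \<gamma>_rules(1) on_triple)
  qed
  have p\<gamma>: "p (\<gamma> e) = \<alpha> (p e)" for e
    by (simp add: \<gamma>_def p_rules sectionD(2)[OF t])
  have "inj \<gamma>"
  proof (rule injI)
    fix e f assume eq: "\<gamma> e = \<gamma> f"
    then have "\<alpha> (p e) = \<alpha> (p f)" by (metis p\<gamma>)
    then have "p e = p f" by (metis ly_autD(3)[OF \<alpha>])
    moreover from this eq have "\<beta> (inv i (e - s (p e))) = \<beta> (inv i (f - s (p f)))"
      by (simp add: \<gamma>_def i_eq_iff)
    then have "inv i (e - s (p e)) = inv i (f - s (p f))" by (metis ly_autD(3)[OF \<beta>])
    then have "e - s (p e) = f - s (p f)"
      by (metis i_inv_i p_rules(3) sectionD(2)[OF s] diff_self)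
    ultimately show "e = f" by simp
  qed
  moreover have "surj \<gamma>"
  proof (rule surjI)
    fix e
    show "\<gamma> (s (inv \<alpha> (p e)) + i (inv \<beta> (inv i (e - t (p e))))) = e"
      by (simp add: \<gamma>_split ly_autD(2)[OF \<alpha>] ly_autD(2)[OF \<beta>] i_inv_i p_rules sectionD(2)[OF t])
  qed
  moreover have "\<gamma> ` range i = range i"
    by (auto simp: \<gamma>_i image_image) (metis ly_autD(2)[OF \<beta>] rangeI)
  ultimately have "\<gamma> \<in> aut_preserving E (range i)"
    using \<gamma>_hom by (simp add: aut_preserving_def ly_aut_def bij_def)
  moreover have "i \<circ> \<beta> = \<gamma> \<circ> i" "p \<circ> \<gamma> = \<alpha> \<circ> p"
    by (auto simp: \<gamma>_i p\<gamma>)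
  ultimately show ?thesis
    unfolding extensible_def by blast
qed

end

theorem theorem5p4:
  fixes G :: "('k::field, 'g::ab_group_add) ly_algebra"
    and H :: "('k, 'h::ab_group_add) ly_algebra"
    and E :: "('k, 'e::ab_group_add) ly_algebra"
    and i :: "'h \<Rightarrow> 'e" and p :: "'e \<Rightarrow> 'g" and s :: "'g \<Rightarrow> 'e"
    and \<alpha> :: "'g \<Rightarrow> 'g" and \<beta> :: "'h \<Rightarrow> 'h"
  assumes "nonabelian_extension G H E i p"
    and "is_section G E p s"
    and "\<alpha> \<in> ly_aut G" and "\<beta> \<in> ly_aut H"
  shows "extensible E i p \<alpha> \<beta> \<longleftrightarrow>
    equivalent_cocycles G H (induced_cocycle G E i s) (twist \<alpha> \<beta> (induced_cocycle G E i s))"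
proof -
  interpret nonabelian_extension G H E i p by (fact assms(1))
  show ?thesis
    unfolding equivalent_induced_iff[OF assms(2)]
  proof
    assume "extensible E i p \<alpha> \<beta>"
    then obtain \<gamma> where "\<gamma> \<in> ly_hom E E" "i \<circ> \<beta> = \<gamma> \<circ> i" "p \<circ> \<gamma> = \<alpha> \<circ> p"
      by (auto simp: extensible_def aut_preserving_def ly_aut_def)
    then show "\<exists>t. is_section G E p t \<and>
        twist \<alpha> \<beta> (induced_cocycle G E i s) = induced_cocycle G E i t"
      using twist_induced[OF assms(2,3,4), of \<gamma>] by (metis comp_apply)
  next
    assume "\<exists>t. is_section G E p t \<and>
        twist \<alpha> \<beta> (induced_cocycle G E i s) = induced_cocycle G E i t"
    then show "extensible E i p \<alpha> \<beta>"
      using extensible_if_twist_induced[OF assms(2) _ assms(3,4)] by blast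
  qed
qed

end
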